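(* Let $k\ge 1$ be an integer, let $P=(E,r)$ be a $k$-polymatroid and let $P^*$ be its ($k$-)dual. Then $$T_k(P^*;x,y)=T_k(P;y,x).$$
   Context: A polymatroid is a pair $P=(E,r)$ with $E$ a finite set and $r:2^E\to\mathbb{Z}$ such that $r(\emptyset)=0$, $r(A)\le r(B)$ whenever $A\subseteq B$, and $r(A)+r(B)\ge r(A\cup B)+r(A\cap B)$ for all $A,B\subseteq E$. It is a $k$-polymatroid if $r(\{e\})\le k$ for all $e\in E$. The $k$-dual of a $k$-polymatroid $P=(E,r)$ is $P^*=(E,r^* )$ with $r^*(A)=k|A|+r(E\setminus A)-r(E)$ for $A\subseteq E$ (again a $k$-polymatroid). $k$-polymatroid Tutte polynomial: $T_k(P;x,y)=\sum_{A\subseteq E}(x-1)^{r(E)-r(A)}(y-1)^{k|A|-r(A)}$. *)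

theory Defs
  imports Main
begin

locale polymatroid =
  fixes E :: "'a set" and r :: "'a set \<Rightarrow> int"
  assumes finite_ground: "finite E"
    and rank_empty: "r {} = 0"
    and rank_mono: "\<lbrakk>A \<subseteq> B; B \<subseteq> E\<rbrakk> \<Longrightarrow> r A \<le> r B"
    and rank_submodular:
      "\<lbrakk>A \<subseteq> E; B \<subseteq> E\<rbrakk> \<Longrightarrow> r (A \<union> B) + r (A \<inter> B) \<le> r A + r B"

locale k_polymatroid = polymatroid E r
  for k :: nat and E :: "'a set" and r :: "'a set \<Rightarrow> int" +
  assumes rank_singleton: "e \<in> E \<Longrightarrow> r {e} \<le> int k"

text \<open>The \<open>k\<close>-dual of \<open>(E, r)\<close> is \<open>(E, dual_rank k E r)\<close>.\<close>

definition dual_rank :: "nat \<Rightarrow> 'a set \<Rightarrow> ('a set \<Rightarrow> int) \<Rightarrow> 'a set \<Rightarrow> int" where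
  "dual_rank k E r A = int k * int (card A) + r (E - A) - r E"

text \<open>
  The polynomial is evaluated at elements of an arbitrary commutative ring; taking these to be
  the two indeterminates of a polynomial ring over the integers gives the polynomial itself.
  For a \<open>k\<close>-polymatroid both integer exponents are nonnegative, so \<open>nat\<close> does not truncate them.
\<close>

definition k_tutte ::
    "nat \<Rightarrow> 'a set \<Rightarrow> ('a set \<Rightarrow> int) \<Rightarrow> 'b::comm_ring_1 \<Rightarrow> 'b \<Rightarrow> 'b" where
  "k_tutte k E r x y =
    (\<Sum>A\<in>Pow E. (x - 1) ^ nat (r E - r A) * (y - 1) ^ nat (int k * int (card A) - r A))"

end

theory Submission imports Defs begin

text \<open>As \<open>r {} = 0\<close>, the dual rank of \<open>E\<close> is
  \<open>k * card E - r E\<close>; the two copies of \<open>r E\<close> cancel in the difference,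
  and the cardinalities combine to that of the complement.\<close>

lemma dual_rank_corank:
  assumes "finite E" and "r {} = 0" and "A \<subseteq> E"
  shows "dual_rank k E r E - dual_rank k E r A = int k * int (card (E - A)) - r (E - A)"
proof -
  have "int (card (E - A)) = int (card E) - int (card A)"
    using assms by (simp add: card_Diff_subset finite_subset card_mono of_nat_diff)
  then show ?thesis
    using assms by (simp add: dual_rank_def right_diff_distrib)
qed

lemma dual_rank_nullity:
  "int k * int (card A) - dual_rank k E r A = r E - r (E - A)"
  by (simp add: dual_rank_def)

text \<open>
  Complementation \<open>A \<mapsto> E - A\<close> exchanges corank and \<open>k\<close>-nullity between a \<open>k\<close>-polymatroid and
  its dual, so reindexing the sum by complements swaps the two variables.
\<close>

theorem proposition3p5:
  fixes k :: nat and E :: "'a set" and r :: "'a set \<Rightarrow> int" and x y :: "'b::comm_ring_1"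
  assumes "k \<ge> 1" and "k_polymatroid k E r"
  shows "k_tutte k E (dual_rank k E r) x y = k_tutte k E r y x"
proof -
  interpret k_polymatroid k E r by fact
  show ?thesis
    unfolding k_tutte_def
    \<comment> \<open>Complementation is an involution on \<open>Pow E\<close>, hence its own
      inverse witness. The exponents agree as integers, already before \<open>nat\<close>; the two
      factors only appear in opposite order, whence \<open>mult.commute\<close>.\<close>
    by (rule sum.reindex_bij_witness[where i = "\<lambda>A. E - A" and j = "\<lambda>A. E - A"])
      (auto simp: dual_rank_corank[of E r, OF finite_ground rank_empty] dual_rank_nullity
        double_diff mult.commute)
qed

end
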